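(* Let $\beta>1$ be a generalized Parry number. Then every Galois conjugate $z\in\mathbb{C}$ of $\beta$ satisfies $|z|<2$.
   Context: Let $m\geq 1$ be an integer, $\beta\in(m,m+1]$ and $E=(E(0),\ldots,E(m))\in\{1,-1\}^{m+1}$. Partition $[0,1]$ into $I_0=[0,1/\beta]$, $I_k=(k/\beta,(k+1)/\beta]$ for $1\leq k\leq m-1$, and $I_m=(m/\beta,1]$. The generalized $\beta$-transformation (or $(\beta,E)$-transformation) $f=f_{\beta,E}:[0,1]\to[0,1]$ is given by $f(x)=\beta x-k$ if $x\in I_k$ and $E(k)=1$, and $f(x)=-\beta x+k+1$ if $x\in I_k$ and $E(k)=-1$. It is called post-critically finite (PCF) if the orbit $\{f^j(1): j\geq 0\}$ is a finite set. A real number $\beta>1$ is a generalized Parry number if there is an $E\in\{1,-1\}^{m+1}$ (where $\beta\in(m,m+1]$) such that $f_{\beta,E}$ is PCF. Such a $\beta$ is an algebraic number. The Galois conjugates of $\beta$ are the complex roots, other than $\beta$ itself, of the minimal polynomial of $\beta$ over $\mathbb{Q}$. *)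

theory Defs
  imports Complex_Main "HOL-Computational_Algebra.Computational_Algebra"
begin

section \<open>Generalized beta-transformations\<close>

definition beta_piece :: "real \<Rightarrow> nat \<Rightarrow> nat \<Rightarrow> real set" where
  "beta_piece \<beta> m k =
     (if k = 0 then {0 .. 1 / \<beta>}
      else if k = m then {real m / \<beta> <.. 1}
      else {real k / \<beta> <.. (real k + 1) / \<beta>})"

text \<open>
  The signs \<open>E(0), \<dots>, E(m)\<close> are given by a function on the naturals of which only the
  values at \<open>k \<le> m\<close> are used.  The map is only meaningful on \<open>{0..1}\<close>, which it maps
  into itself; see \<open>beta_map_in_unit\<close> below.
\<close>

definition beta_map :: "real \<Rightarrow> nat \<Rightarrow> (nat \<Rightarrow> int) \<Rightarrow> real \<Rightarrow> real" where
  "beta_map \<beta> m E x =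
     (let k = (THE k. k \<le> m \<and> x \<in> beta_piece \<beta> m k)
      in if E k = 1 then \<beta> * x - real k else - \<beta> * x + real k + 1)"

definition PCF :: "real \<Rightarrow> nat \<Rightarrow> (nat \<Rightarrow> int) \<Rightarrow> bool" where
  "PCF \<beta> m E \<longleftrightarrow> finite {(beta_map \<beta> m E ^^ j) 1 | j. True}"

definition generalized_Parry :: "real \<Rightarrow> bool" where
  "generalized_Parry \<beta> \<longleftrightarrow> \<beta> > 1 \<and>
     (\<exists>m E. m \<ge> 1 \<and> \<beta> \<in> {real m <.. real m + 1} \<and> (\<forall>k\<le>m. E k \<in> {1, -1}) \<and> PCF \<beta> m E)"

lemma beta_piece_iff:
  assumes "\<beta> > 0" "x \<in> {0..1}"
  shows "x \<in> beta_piece \<beta> m k \<longleftrightarrow>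
      (if k = 0 then \<beta> * x \<le> 1 else if k = m then real m < \<beta> * x
       else real k < \<beta> * x \<and> \<beta> * x \<le> real k + 1)"
  using assms
  by (simp add: beta_piece_def pos_divide_less_eq pos_le_divide_eq mult.commute)

lemma beta_mult_le:
  assumes "\<beta> \<in> {real m <.. real m + 1}" "x \<in> {0..1}"
  shows "\<beta> * x \<le> real m + 1"
proof -
  have "\<beta> \<ge> 0" using assms(1) by simp
  then have "\<beta> * x \<le> \<beta>" using assms(2) by (intro mult_left_le) simp_all
  also have "\<beta> \<le> real m + 1" using assms(1) by simp
  finally show ?thesis .
qed

lemma beta_piece_ex1:
  assumes m: "m \<ge> 1" and \<beta>: "\<beta> \<in> {real m <.. real m + 1}" and x: "x \<in> {0..1}"
  shows "\<exists>!k. k \<le> m \<and> x \<in> beta_piece \<beta> m k"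
proof -
  have pos: "\<beta> > 0" using m \<beta> by simp
  note piece = beta_piece_iff[OF pos x]
  note le = beta_mult_le[OF \<beta> x]
  show ?thesis
  proof (cases "\<beta> * x \<le> 1")
    case True
    have "j = 0" if "x \<in> beta_piece \<beta> m j" for j
    proof (rule ccontr)
      assume "j \<noteq> 0"
      then have "real j < \<beta> * x" "real j \<ge> 1"
        using that by (simp_all add: piece split: if_splits)
      then show False using True by linarith
    qed
    moreover have "x \<in> beta_piece \<beta> m 0" using True by (simp add: piece)
    ultimately show ?thesis by blast
  next
    case False
    define k where "k = nat (\<lceil>\<beta> * x\<rceil> - 1)"
    have k: "real k < \<beta> * x" "\<beta> * x \<le> real k + 1" "k \<ge> 1"
      using False unfolding k_def by linarith+
    have "k \<le> m" using k(1) le by linarith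
    moreover have "j = k" if "j \<le> m" "x \<in> beta_piece \<beta> m j" for j
    proof -
      have "j \<noteq> 0" using that(2) False by (cases "j = 0") (simp_all add: piece)
      then have "real j < \<beta> * x" "\<beta> * x \<le> real j + 1"
        using that(2) le by (simp_all add: piece split: if_splits)
      then show ?thesis using k by linarith
    qed
    moreover have "x \<in> beta_piece \<beta> m k" using k by (simp add: piece)
    ultimately show ?thesis by blast
  qed
qed

lemma beta_map_eq:
  assumes "m \<ge> 1" "\<beta> \<in> {real m <.. real m + 1}" "x \<in> {0..1}" "k \<le> m" "x \<in> beta_piece \<beta> m k"
  shows "beta_map \<beta> m E x = (if E k = 1 then \<beta> * x - real k else - \<beta> * x + real k + 1)"
proof -
  have "(THE k. k \<le> m \<and> x \<in> beta_piece \<beta> m k) = k"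
    using beta_piece_ex1[OF assms(1-3)] assms(4,5) by (intro the1_equality) auto
  then show ?thesis by (simp add: beta_map_def)
qed

lemma beta_map_in_unit:
  assumes m: "m \<ge> 1" and \<beta>: "\<beta> \<in> {real m <.. real m + 1}" and x: "x \<in> {0..1}"
  shows "beta_map \<beta> m E x \<in> {0..1}"
proof -
  obtain k where k: "k \<le> m" "x \<in> beta_piece \<beta> m k"
    using beta_piece_ex1[OF assms] by auto
  have pos: "\<beta> > 0" using m \<beta> by simp
  have "0 \<le> \<beta> * x" using pos x by simp
  then have "real k \<le> \<beta> * x" "\<beta> * x \<le> real k + 1"
    using k(2) beta_mult_le[OF \<beta> x]
    by (simp_all add: beta_piece_iff[OF pos x] split: if_splits)
  then show ?thesis by (simp add: beta_map_eq[OF assms k])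
qed


section \<open>Minimal polynomials over the rationals and Galois conjugates\<close>

text \<open>
  The type-class analogue of \<open>Irr\<close> from \<open>HOL-Algebra.Finite_Extensions\<close>.
  It is well defined for algebraic numbers; see \<open>rat_min_poly_ex1\<close> below.
\<close>

definition rat_min_poly :: "'a :: field_char_0 \<Rightarrow> rat poly" where
  "rat_min_poly x = (THE p. lead_coeff p = 1 \<and> irreducible p \<and> poly (map_poly of_rat p) x = 0)"

definition galois_conjugates :: "real \<Rightarrow> complex set" where
  "galois_conjugates \<beta> =
     {z. z \<noteq> of_real \<beta> \<and> poly (map_poly of_rat (rat_min_poly \<beta>)) z = 0}"

lemma map_poly_of_rat_add:
  "map_poly of_rat (p + q) = (map_poly of_rat p + map_poly of_rat q :: 'a :: field_char_0 poly)"
  by (rule poly_eqI) (simp add: coeff_map_poly of_rat_add)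

lemma map_poly_of_rat_mult:
  "map_poly of_rat (p * q) = (map_poly of_rat p * map_poly of_rat q :: 'a :: field_char_0 poly)"
  by (rule poly_eqI) (simp add: coeff_map_poly coeff_mult of_rat_sum of_rat_mult)

lemma rat_root_dvd_if_least_degree:
  fixes x :: "'a :: field_char_0"
  assumes p: "p \<noteq> 0" "poly (map_poly of_rat p) x = 0"
    and least: "\<And>q. q \<noteq> 0 \<Longrightarrow> poly (map_poly of_rat q) x = 0 \<Longrightarrow> degree p \<le> degree q"
    and q: "poly (map_poly of_rat q) x = 0"
  shows "p dvd q"
proof -
  have "poly (map_poly of_rat (q div p * p + q mod p)) x = 0" using q by simp
  then have "poly (map_poly of_rat (q mod p)) x = 0"
    unfolding map_poly_of_rat_add map_poly_of_rat_mult using p(2) by simp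
  then have "q mod p = 0"
    using least[of "q mod p"] degree_mod_less[OF p(1), of q] by fastforce
  then show ?thesis by auto
qed

lemma ex_rat_poly_least_degree:
  fixes x :: "'a :: field_char_0"
  assumes "q \<noteq> 0" "poly (map_poly of_rat q) x = 0"
  obtains p where "p \<noteq> 0" "poly (map_poly of_rat p) x = 0"
    "\<And>q. q \<noteq> 0 \<Longrightarrow> poly (map_poly of_rat q) x = 0 \<Longrightarrow> degree p \<le> degree q"
  using ex_has_least_nat[of "\<lambda>q. q \<noteq> 0 \<and> poly (map_poly of_rat q) x = 0" q degree] assms
  by blast

lemma rat_root_not_unit:
  fixes x :: "'a :: field_char_0"
  assumes "poly (map_poly of_rat p) x = 0"
  shows "\<not> p dvd 1"
proof
  assume "p dvd 1"
  then obtain q where "1 = p * q" by (rule dvdE)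
  then have "map_poly of_rat p * map_poly of_rat q = (1 :: 'a poly)"
    using map_poly_of_rat_mult[of p q, where 'a = 'a] by simp
  then have "poly (map_poly of_rat p * map_poly of_rat q) x = 1"
    by simp
  then show False using assms by simp
qed

lemma irreducible_rat_root_dvd:
  fixes x :: "'a :: field_char_0"
  assumes p: "irreducible p" "poly (map_poly of_rat p) x = 0"
    and q: "poly (map_poly of_rat q) x = 0"
  shows "p dvd q"
proof -
  have "p \<noteq> 0" using p(1) by auto
  then obtain d where d: "d \<noteq> 0" "poly (map_poly of_rat d) x = 0"
    "\<And>q. q \<noteq> 0 \<Longrightarrow> poly (map_poly of_rat q) x = 0 \<Longrightarrow> degree d \<le> degree q"
    using p(2) by (rule ex_rat_poly_least_degree) (blast intro: that)
  have dvd: "d dvd p" "d dvd q"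
    using rat_root_dvd_if_least_degree[OF d] p(2) q by auto
  have "\<not> d dvd 1" using d(2) by (rule rat_root_not_unit)
  then have "p dvd d" using irreducibleD'[OF p(1) dvd(1)] by auto
  then show ?thesis using dvd(2) by (rule dvd_trans)
qed

lemma rat_min_poly_ex1:
  fixes x :: "'a :: field_char_0"
  assumes "algebraic x"
  shows "\<exists>!p :: rat poly. lead_coeff p = 1 \<and> irreducible p \<and> poly (map_poly of_rat p) x = 0"
proof -
  let ?root = "\<lambda>p :: rat poly. poly (map_poly of_rat p) x = 0"
  obtain p0 where p0: "\<And>i. coeff p0 i \<in> \<rat>" "p0 \<noteq> 0" "poly p0 x = 0"
    using assms unfolding algebraic_altdef by blast
  obtain q0 where "p0 = map_poly of_rat q0" using p0(1) by (rule ratpolyE)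
  then have "q0 \<noteq> 0" "?root q0" using p0(2,3) by auto
  then obtain p where p: "p \<noteq> 0" "?root p" and
      min: "\<And>q. q \<noteq> 0 \<Longrightarrow> ?root q \<Longrightarrow> degree p \<le> degree q"
    by (rule ex_rat_poly_least_degree) (blast intro: that)
  have "irreducible p"
  proof (rule irreducibleI)
    show "\<not> p dvd 1" using p(2) by (rule rat_root_not_unit)
  next
    fix a b assume ab: "p = a * b"
    have nz: "a \<noteq> 0" "b \<noteq> 0" using ab p(1) by auto
    have "?root a \<or> ?root b" using p(2) by (simp add: ab map_poly_of_rat_mult)
    then have "degree a = 0 \<or> degree b = 0"
      using min[of a] min[of b] nz by (auto simp: ab degree_mult_eq)
    then show "a dvd 1 \<or> b dvd 1" using nz by (auto simp: is_unit_iff_degree)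
  qed (use p in auto)
  define c where "c = inverse (lead_coeff p)"
  have c: "c \<noteq> 0" using p(1) by (simp add: c_def)
  have "irreducible (smult c p)"
    using \<open>irreducible p\<close> c irreducible_mult_unit_left[of "[:c:]" p]
    by (simp add: is_unit_const_poly_iff dvd_field_iff)
  moreover have "?root (smult c p)"
    using p(2) by (simp add: map_poly_smult of_rat_mult)
  moreover have "lead_coeff (smult c p) = 1" using p(1) by (simp add: c_def)
  moreover have "q = r" if "lead_coeff q = 1 \<and> irreducible q \<and> ?root q"
      "lead_coeff r = 1 \<and> irreducible r \<and> ?root r" for q r
  proof -
    have "q dvd r" "r dvd q"
      using that irreducible_rat_root_dvd[of q x r] irreducible_rat_root_dvd[of r x q] by simp_all
    have nz: "q \<noteq> 0" "r \<noteq> 0" using that by auto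
    obtain s where s: "r = q * s" using \<open>q dvd r\<close> by (rule dvdE)
    have "degree r \<le> degree q" using \<open>r dvd q\<close> nz(1) by (rule dvd_imp_degree_le)
    then have "degree s = 0" using nz by (simp add: s degree_mult_eq)
    then obtain a where a: "s = [:a:]" by (rule degree_eq_zeroE)
    have "lead_coeff r = lead_coeff q * lead_coeff s" by (simp only: s lead_coeff_mult)
    then have "a = 1" using that by (simp add: a)
    then show ?thesis by (simp add: s a)
  qed
  ultimately show ?thesis by blast
qed

end

(*
  Write x_n for the orbit of 1, so that x_(n+1) = s_n * beta * x_n + d_n with s_n = +1 or -1 and
  d_n an integer.  Hence x_n = Q_n(beta) for integer polynomials Q_n.  For a conjugate z put
  y_n = Q_n(z); an equality x_i = x_j forces y_i = y_j, so y_n takes finitely many values.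
  With e_n = s_0 ... s_(n-1), the differences c_n = e_n (x_n - y_n) are therefore bounded,
  and c_(n+1) = z c_n + (beta - z) e_n x_n.  If |z| > 1, dividing by z^n gives that w = 1/z is a
  zero of the power series with coefficients e_n x_n, which lie in [-1, 1] and start with 1.
  This forces |w| >= 1/2, and equality would need e_1 x_1 = 1 or -1 and e_2 x_2 = -1.
  The former makes x_1 = 1 = x_0, hence s_1 = s_0 and e_2 = 1, which excludes the latter.
*)
theory Submission
  imports Defs
begin

text \<open>Every rational polynomial with root \<open>\<beta>\<close> is a multiple of the minimal
  polynomial, which vanishes at \<open>z\<close>.\<close>

lemma galois_conjugate_root:
  assumes "algebraic \<beta>" "z \<in> galois_conjugates \<beta>" "poly (map_poly of_rat q) \<beta> = 0"
  shows "poly (map_poly of_rat q) z = 0"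
proof -
  have "irreducible (rat_min_poly \<beta>) \<and> poly (map_poly of_rat (rat_min_poly \<beta>)) \<beta> = 0"
    using theI'[OF rat_min_poly_ex1[OF assms(1)]] unfolding rat_min_poly_def by blast
  then have "rat_min_poly \<beta> dvd q"
    using irreducible_rat_root_dvd assms(3) by blast
  then obtain r where "q = rat_min_poly \<beta> * r" by (rule dvdE)
  then show ?thesis
    using assms(2) by (simp add: galois_conjugates_def map_poly_of_rat_mult)
qed

lemma algebraic_if_rat_root:
  fixes x :: "'a :: field_char_0"
  assumes "q \<noteq> 0" "poly (map_poly of_rat q) x = 0"
  shows "algebraic x"
  unfolding algebraic_altdef
proof (intro exI conjI allI)
  show "coeff (map_poly of_rat q :: 'a poly) i \<in> \<rat>" for i by (simp add: coeff_map_poly)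
  show "map_poly of_rat q \<noteq> (0 :: 'a poly)" using assms(1) by (simp add: map_poly_eq_0_iff)
qed (rule assms(2))

lemma map_poly_of_rat_diff:
  "map_poly of_rat (p - q) = (map_poly of_rat p - map_poly of_rat q :: 'a :: field_char_0 poly)"
  by (rule poly_eqI) (simp add: coeff_map_poly of_rat_diff)

text \<open>These are the Q_n. Rational coefficients let the same polynomial be evaluated at the
  real \<open>\<beta>\<close> and at a complex conjugate.\<close>

primrec orbit_poly :: "(nat \<Rightarrow> int) \<Rightarrow> (nat \<Rightarrow> int) \<Rightarrow> nat \<Rightarrow> rat poly" where
  "orbit_poly s d 0 = 1"
| "orbit_poly s d (Suc n) = pCons (of_int (d n)) (smult (of_int (s n)) (orbit_poly s d n))"

abbreviation orbit_val :: "(nat \<Rightarrow> int) \<Rightarrow> (nat \<Rightarrow> int) \<Rightarrow> nat \<Rightarrow> 'a \<Rightarrow> 'a :: field_char_0" where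
  "orbit_val s d n x \<equiv> poly (map_poly of_rat (orbit_poly s d n)) x"

lemma orbit_val_Suc:
  "orbit_val s d (Suc n) x = of_int (s n) * x * orbit_val s d n x + of_int (d n)"
  by (simp add: map_poly_pCons map_poly_smult of_rat_mult algebra_simps)

lemma degree_orbit_poly:
  assumes "\<And>n. s n \<noteq> 0"
  shows "orbit_poly s d n \<noteq> 0 \<and> degree (orbit_poly s d n) = n"
  by (induction n) (use assms in auto)

text \<open>By pigeonhole some Q_i - Q_j with distinct i, j vanishes at \<open>\<beta>\<close>; it
  is not the zero polynomial because the degrees i and j differ.\<close>

lemma algebraic_if_finite_orbit:
  fixes \<beta> :: "'a :: field_char_0"
  assumes "\<And>n. s n \<noteq> 0" "finite (range (\<lambda>n. orbit_val s d n \<beta>))"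
  shows "algebraic \<beta>"
proof -
  have "\<not> inj (\<lambda>n. orbit_val s d n \<beta>)"
    using assms(2) finite_imageD infinite_UNIV_nat by blast
  then obtain i j where ij: "i \<noteq> j" "orbit_val s d i \<beta> = orbit_val s d j \<beta>"
    by (auto simp: inj_def)
  have "orbit_poly s d i - orbit_poly s d j \<noteq> 0"
    using degree_orbit_poly[of s d i] degree_orbit_poly[of s d j] assms(1) ij(1) by auto
  then show ?thesis
    by (rule algebraic_if_rat_root) (simp add: map_poly_of_rat_diff ij(2))
qed

lemma finite_conjugate_orbit:
  assumes s: "\<And>n. s n \<noteq> 0" and fin: "finite (range (\<lambda>n. orbit_val s d n \<beta>))"
    and z: "z \<in> galois_conjugates \<beta>"
  shows "finite (range (\<lambda>n. orbit_val s d n z))"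
proof -
  let ?x = "\<lambda>n. orbit_val s d n \<beta>" and ?y = "\<lambda>n. orbit_val s d n z"
  have alg: "algebraic \<beta>" using s fin by (rule algebraic_if_finite_orbit)
  have eq: "?y i = ?y j" if "?x i = ?x j" for i j
    using galois_conjugate_root[OF alg z, of "orbit_poly s d i - orbit_poly s d j"] that
    by (simp add: map_poly_of_rat_diff)
  \<comment> \<open>\<open>inv ?x\<close> picks one index for each orbit value, so
    \<open>?y n\<close> is a function of \<open>?x n\<close>.\<close>
  have "?y n = ?y (inv ?x (?x n))" for n
    by (rule eq) (simp add: f_inv_into_f[of _ ?x UNIV])
  then have "range ?y \<subseteq> (\<lambda>v. ?y (inv ?x v)) ` range ?x" by blast
  then show ?thesis using fin by (meson finite_imageI finite_subset)
qed

lemma signed_orbit_sums_0: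
  fixes \<beta> :: real and z :: complex
  assumes s: "\<And>n. s n \<in> {1, -1}" and fin: "finite (range (\<lambda>n. orbit_val s d n \<beta>))"
    and z: "z \<in> galois_conjugates \<beta>" "cmod z > 1"
  shows "(\<lambda>n. of_real (of_int (\<Prod>i<n. s i) * orbit_val s d n \<beta>) * (1 / z) ^ n) sums 0"
proof -
  define a where "a n = (of_real (of_int (\<Prod>i<n. s i) * orbit_val s d n \<beta>) :: complex)" for n
  define b where "b n = of_int (\<Prod>i<n. s i) * orbit_val s d n z" for n
  have s0: "s n \<noteq> 0" for n using s[of n] by auto
  have z0: "z \<noteq> 0" and zb: "z \<noteq> of_real \<beta>" using z by (auto simp: galois_conjugates_def)
  have sq: "of_int (s n) * of_int (s n) = (1 :: complex)" for n
    using s[of n] by auto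
  \<comment> \<open>The new sign factor cancels against the sign in the recurrence. Both sequences
    then have the same inhomogeneous term, which drops out of \<open>a n - b n\<close>.\<close>
  have aS: "a (Suc n) = of_real \<beta> * a n + of_int (\<Prod>i<Suc n. s i) * of_int (d n)"
    and bS: "b (Suc n) = z * b n + of_int (\<Prod>i<Suc n. s i) * of_int (d n)" for n
    using sq[of n] unfolding a_def b_def orbit_val_Suc by (auto simp: algebra_simps)
  \<comment> \<open>Writing \<open>z ^ n / z\<close> for the power n - 1 covers n = 0 as
    well.\<close>
  have partial: "a n - b n = (of_real \<beta> - z) * z ^ n / z * (\<Sum>i<n. a i * (1 / z) ^ i)" for n
  proof (induction n)
    case 0
    then show ?case by (simp add: a_def b_def)
  next
    case (Suc n)
    have "a (Suc n) - b (Suc n) = z * (a n - b n) + (of_real \<beta> - z) * a n"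
      unfolding aS bS by (simp add: algebra_simps)
    also have "\<dots> = (of_real \<beta> - z) * z ^ n * (\<Sum>i<n. a i * (1 / z) ^ i) + (of_real \<beta> - z) * a n"
      unfolding Suc using z0 by simp
    also have "\<dots> = (of_real \<beta> - z) * z ^ Suc n / z * (\<Sum>i<Suc n. a i * (1 / z) ^ i)"
      using z0 by (simp add: field_simps)
    finally show ?case .
  qed
  have norm_sign: "cmod (of_int (\<Prod>i<n. s i)) = 1" for n
  proof (induction n)
    case (Suc n)
    then show ?case using s[of n] by (auto simp: norm_mult)
  qed simp
  define u where "u n = of_real (orbit_val s d n \<beta>) - orbit_val s d n z" for n
  have "range u \<subseteq> (\<lambda>(p, q). of_real p - q) `
      (range (\<lambda>n. orbit_val s d n \<beta>) \<times> range (\<lambda>n. orbit_val s d n z))"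
    by (auto simp: u_def)
  then have fin_u: "finite (range u)"
    using fin finite_conjugate_orbit[OF s0 fin z(1)]
    by (meson finite_SigmaI finite_imageI finite_subset)
  have "a n - b n = of_int (\<Prod>i<n. s i) * u n" for n
    by (simp add: a_def b_def u_def algebra_simps)
  then have "cmod (a n - b n) = cmod (u n)" for n
    by (simp only: norm_mult norm_sign)
  then have "cmod (a n - b n) \<le> Max (cmod ` range u)" for n
    using fin_u by simp
  then have "Bseq (\<lambda>n. a n - b n)" by (rule BseqI')
  moreover have "(\<lambda>n. z / (of_real \<beta> - z) * (1 / z) ^ n) \<longlonglongrightarrow> 0"
    using z(2) by (intro tendsto_mult_right_zero LIMSEQ_power_zero) (simp add: norm_divide divide_less_eq)
  \<comment> \<open>A null sequence times a bounded one; by \<open>partial\<close> the product is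
    the n-th partial sum.\<close>
  ultimately have "(\<lambda>n. (z / (of_real \<beta> - z) * (1 / z) ^ n) * (a n - b n)) \<longlonglongrightarrow> 0"
    unfolding tendsto_Zfun_iff diff_zero
    by (rule bounded_bilinear.Zfun_prod_Bfun[OF bounded_bilinear_mult, rotated])
  moreover have "(z / (of_real \<beta> - z) * (1 / z) ^ n) * (a n - b n) = (\<Sum>i<n. a i * (1 / z) ^ i)" for n
    unfolding partial using z0 zb by (simp add: power_one_over)
  ultimately show ?thesis unfolding sums_def a_def by simp
qed

text \<open>The real parts of the terms with n \<ge> 1 sum to -1, while each is at least -1/2^n and
  these bounds also sum to -1. So every term attains its bound; n = 1 and n = 2 give the two
  claims.\<close>

lemma coeffs_if_small_zero:
  fixes a :: "nat \<Rightarrow> real" and w :: complex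
  assumes a0: "a 0 = 1" and a: "\<And>n. \<bar>a n\<bar> \<le> 1" and w: "cmod w \<le> 1 / 2"
    and sums: "(\<lambda>n. of_real (a n) * w ^ n) sums 0"
  shows "\<bar>a 1\<bar> = 1" "a 2 = -1"
proof -
  \<comment> \<open>The slack in the bound for the term of index n + 1.\<close>
  define g where "g n = Re (of_real (a (Suc n)) * w ^ Suc n) + (1 / 2) ^ Suc n" for n
  have "(\<lambda>n. Re (of_real (a n) * w ^ n)) sums 0"
    using sums_Re[OF sums] by simp
  then have "(\<lambda>n. Re (of_real (a (Suc n)) * w ^ Suc n)) sums (-1)"
    by (subst sums_Suc_iff) (simp add: a0)
  moreover have "(\<lambda>n. (1 / 2 :: real) ^ Suc n) sums 1" by (rule power_half_series)
  ultimately have "g sums (-1 + 1)" unfolding g_def by (rule sums_add)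
  then have "summable g" "suminf g = 0" by (auto simp: sums_iff)
  moreover have "0 \<le> g n" for n
  proof -
    have "cmod (of_real (a (Suc n)) * w ^ Suc n) \<le> 1 * (1 / 2) ^ Suc n"
      unfolding norm_mult norm_power using a w by (intro mult_mono power_mono) auto
    then show ?thesis
      using abs_Re_le_cmod[of "of_real (a (Suc n)) * w ^ Suc n"] by (simp add: g_def)
  qed
  ultimately have g: "g n = 0" for n using suminf_eq_zero_iff by blast
  have aw: "a 1 * Re w = - (1 / 2)" using g[of 0] by (simp add: g_def)
  have "\<bar>Re w\<bar> \<le> 1 / 2" using abs_Re_le_cmod[of w] w by linarith
  moreover have "\<bar>a 1\<bar> * \<bar>Re w\<bar> = 1 / 2" using aw by (simp flip: abs_mult)
  moreover have "\<bar>a 1\<bar> * \<bar>Re w\<bar> \<le> \<bar>Re w\<bar>"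
    using a[of 1] by (simp add: mult_left_le_one_le)
  ultimately have Re: "\<bar>Re w\<bar> = 1 / 2" by linarith
  then show "\<bar>a 1\<bar> = 1" using \<open>\<bar>a 1\<bar> * \<bar>Re w\<bar> = 1 / 2\<close> unfolding Re by linarith
  \<comment> \<open>The real part already exhausts the bound on \<open>cmod w\<close>, so
    \<open>w\<close> is real and its square is 1/4.\<close>
  have "(Re w)\<^sup>2 = (1 / 2)\<^sup>2" using Re by (metis power2_abs)
  then have Re2: "(Re w)\<^sup>2 = 1 / 4" by (simp add: power_divide)
  moreover have "(cmod w)\<^sup>2 \<le> (1 / 2)\<^sup>2" using w by (intro power_mono) auto
  ultimately have "Im w = 0" by (simp add: cmod_power2 power_divide)
  then have "Re (w ^ 2) = 1 / 4" using Re2 by (simp add: Re_power2)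
  moreover have "g 1 = a 2 * Re (w ^ 2) + 1 / 4"
    by (simp add: g_def power_divide flip: numeral_2_eq_2)
  ultimately have "a 2 * (1 / 4) + 1 / 4 = 0" using g[of 1] by metis
  then show "a 2 = -1" by simp
qed

theorem theorem3p3:
  fixes \<beta> :: real
  assumes "\<beta> > 1" and "generalized_Parry \<beta>"
  shows "\<forall>z\<in>galois_conjugates \<beta>. cmod z < 2"
proof (intro ballI, rule ccontr)
  fix z assume z: "z \<in> galois_conjugates \<beta>" "\<not> cmod z < 2"
  obtain m E where m: "m \<ge> 1" "\<beta> \<in> {real m <.. real m + 1}" and PCF: "PCF \<beta> m E"
    using assms(2) unfolding generalized_Parry_def by blast
  define x where "x n = (beta_map \<beta> m E ^^ n) 1" for n
  \<comment> \<open>The same description as in \<open>beta_map\<close>, so that the recurrence for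
    \<open>x\<close> follows by unfolding.\<close>
  define k where "k t = (THE k. k \<le> m \<and> t \<in> beta_piece \<beta> m k)" for t
  define s where "s n = (if E (k (x n)) = 1 then 1 else -1 :: int)" for n
  define d where "d n = (if E (k (x n)) = 1 then - int (k (x n)) else int (k (x n)) + 1)" for n
  have unit: "x n \<in> {0..1}" for n
    unfolding x_def by (induction n) (use beta_map_in_unit[OF m] in auto)
  have xS: "x (Suc n) = of_int (s n) * \<beta> * x n + of_int (d n)" for n
  proof -
    have "x (Suc n) = beta_map \<beta> m E (x n)" by (simp add: x_def)
    then show ?thesis by (simp add: beta_map_def Let_def s_def d_def flip: k_def)
  qed
  have x_eq: "orbit_val s d n \<beta> = x n" for n
  proof (induction n)
    case 0
    then show ?case by (simp add: x_def)
  qed (simp only: orbit_val_Suc xS)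
  have s: "s n \<in> {1, -1}" for n by (simp add: s_def)
  have "range x = {(beta_map \<beta> m E ^^ j) 1 | j. True}" by (auto simp: x_def)
  then have fin: "finite (range (\<lambda>n. orbit_val s d n \<beta>))"
    using PCF by (simp add: x_eq PCF_def)
  define a where "a n = of_int (\<Prod>i<n. s i) * x n" for n
  have sums: "(\<lambda>n. of_real (a n) * (1 / z) ^ n) sums 0"
    using signed_orbit_sums_0[OF s fin z(1)] z(2) by (simp add: a_def x_eq)
  have "\<bar>of_int (\<Prod>i<n. s i)\<bar> = (1 :: real)" for n
  proof (induction n)
    case (Suc n)
    then show ?case using s[of n] by (auto simp: abs_mult)
  qed simp
  then have "\<bar>a n\<bar> \<le> 1" for n using unit[of n] by (simp add: a_def abs_mult)
  moreover have "cmod (1 / z) \<le> 1 / 2"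
    using z(2) frac_le[of 1 1 2 "cmod z"] by (simp add: norm_divide)
  ultimately have a12: "\<bar>a 1\<bar> = 1" "a 2 = -1"
    using coeffs_if_small_zero[OF _ _ _ sums] by (simp_all add: a_def x_def)
  have "x 1 = x 0"
    using a12(1) s[of 0] unit[of 1] by (auto simp: a_def abs_mult x_def)
  \<comment> \<open>The sign \<open>s n\<close> depends on n only through
    \<open>x n\<close>.\<close>
  then have "s 1 = s 0" by (simp only: s_def)
  then have "a 2 = x 2" using s[of 0] by (auto simp: a_def numeral_2_eq_2)
  then show False using a12(2) unit[of 2] by simp
qed

end
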